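(* Let $X$ be a real Banach space, let $\partial$ be a subdifferential on $X$ satisfying the Separation Principle, and let $f:X\to\,]-\infty,+\infty]$ be proper, lower semicontinuous and prox-bounded with threshold $\lambda_f$. Then, for every $\lambda>\lambda_f$, $$\forall x\in X,\quad \operatorname{cl}\bigl(R(\partial f(x+\cdot)+\lambda J)\bigr)=X^*.$$
   Context: $X$ is a real Banach space, $X^*$ its topological dual, $\langle\cdot,\cdot\rangle$ the duality pairing. A function $f:X\to\,]-\infty,+\infty]$ is proper if $\operatorname{dom} f:=\{x\in X: f(x)<\infty\}$ is nonempty; "function on $X$" below means a proper lower semicontinuous function $X\to\,]-\infty,+\infty]$. For a set-valued operator $T:X\rightrightarrows X^*$, its range is $R(T)=\{x^*\in X^*:\exists x\in X,\ x^*\in T(x)\}$. Sums of operators are pointwise: $(S+T)(y)=S(y)+T(y)$ (Minkowski sum, empty if one of the sets is empty). $\partial f(x+\cdot)$ denotes the operator $y\mapsto\partial f(x+y)$. $\operatorname{cl}$ is the norm closure. The duality operator $J:X\rightrightarrows X^*$ is $J(x)=\{x^*\in X^*:\langle x^*,x\rangle=\|x\|^2=\|x^*\|^2\}$. A subdifferential on $X$ is a map $\partial$ that associates to each function $f$ on $X$ a set-valued operator $\partial f:X\rightrightarrows X^*$, such that when $f$ is convex, $\partial f$ is the convex subdifferential $\partial f(x)=\{x^*\in X^*:\langle x^*,y-x\rangle+f(x)\le f(y)\ \forall y\in X\}$. It satisfies the Separation Principle if: for any lower semicontinuous functions $f,\varphi$ on $X$ with $\varphi$ convex and Lipschitz near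 $\bar x\in\operatorname{dom} f\cap\operatorname{dom}\varphi$, if $f+\varphi$ admits a local minimum at $\bar x$, then $0\in\partial f(\bar x)+\partial\varphi(\bar x)$. Let $j(x)=\tfrac12\|x\|^2$. A function $f$ on $X$ is prox-bounded if there exists $\lambda>0$ such that $f+\lambda j$ is bounded from below on $X$; its threshold of prox-boundedness is $\lambda_f:=\inf\{\lambda>0:\inf_X(f+\lambda j)>-\infty\}$. *)

theory Defs
  imports "HOL-Analysis.Analysis"
begin

text \<open>
  The topological dual of a Banach space \<open>'a\<close> is the type \<open>'a \<Rightarrow>\<^sub>L real\<close> with the operator norm.
  Set-valued operators are functions \<open>'a \<Rightarrow> ('a \<Rightarrow>\<^sub>L real) set\<close>, and \<open>+\<close> on sets is the Minkowski sum.
\<close>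

definition dom_fun :: "('a \<Rightarrow> ereal) \<Rightarrow> 'a set" where
  "dom_fun f = {x. f x < \<infinity>}"

definition proper_fun :: "('a \<Rightarrow> ereal) \<Rightarrow> bool" where
  "proper_fun f \<longleftrightarrow> (\<forall>x. f x \<noteq> - \<infinity>) \<and> dom_fun f \<noteq> {}"

text \<open>The filter \<open>at x\<close> is punctured, which makes no difference for the inequality below.\<close>

definition lsc_fun :: "('a::topological_space \<Rightarrow> ereal) \<Rightarrow> bool" where
  "lsc_fun f \<longleftrightarrow> (\<forall>x. f x \<le> Liminf (at x) f)"

definition convex_fun :: "('a::real_vector \<Rightarrow> ereal) \<Rightarrow> bool" where
  "convex_fun f \<longleftrightarrow> (\<forall>x y. \<forall>u\<ge>0. \<forall>v\<ge>0. u + v = 1 \<longrightarrow>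
     f (u *\<^sub>R x + v *\<^sub>R y) \<le> ereal u * f x + ereal v * f y)"

definition lipschitz_near :: "('a::metric_space \<Rightarrow> ereal) \<Rightarrow> 'a \<Rightarrow> bool" where
  "lipschitz_near f x \<longleftrightarrow> (\<exists>U L. open U \<and> x \<in> U \<and> (\<forall>y\<in>U. \<bar>f y\<bar> \<noteq> \<infinity>) \<and>
     L-lipschitz_on U (\<lambda>y. real_of_ereal (f y)))"

definition local_min_at :: "('a::topological_space \<Rightarrow> ereal) \<Rightarrow> 'a \<Rightarrow> bool" where
  "local_min_at f x \<longleftrightarrow> (\<forall>\<^sub>F y in nhds x. f x \<le> f y)"

definition convex_subdiff :: "('a::real_normed_vector \<Rightarrow> ereal) \<Rightarrow> 'a \<Rightarrow> ('a \<Rightarrow>\<^sub>L real) set" where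
  "convex_subdiff f x = {s. \<forall>y. ereal (blinfun_apply s (y - x)) + f x \<le> f y}"

text \<open>
  A subdifferential is only meaningful on proper lower semicontinuous functions;
  its values on all other functions are left unconstrained.
\<close>

definition is_subdifferential ::
    "(('a::real_normed_vector \<Rightarrow> ereal) \<Rightarrow> 'a \<Rightarrow> ('a \<Rightarrow>\<^sub>L real) set) \<Rightarrow> bool" where
  "is_subdifferential D \<longleftrightarrow>
     (\<forall>f. proper_fun f \<and> lsc_fun f \<and> convex_fun f \<longrightarrow> D f = convex_subdiff f)"

definition separation_principle ::
    "(('a::real_normed_vector \<Rightarrow> ereal) \<Rightarrow> 'a \<Rightarrow> ('a \<Rightarrow>\<^sub>L real) set) \<Rightarrow> bool" where
  "separation_principle D \<longleftrightarrow>
     (\<forall>f \<phi> x. proper_fun f \<and> lsc_fun f \<and> proper_fun \<phi> \<and> lsc_fun \<phi> \<and> convex_fun \<phi> \<and>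
        x \<in> dom_fun f \<inter> dom_fun \<phi> \<and> lipschitz_near \<phi> x \<and>
        local_min_at (\<lambda>y. f y + \<phi> y) x \<longrightarrow> 0 \<in> D f x + D \<phi> x)"

definition half_norm_sq :: "'a::real_normed_vector \<Rightarrow> real" where
  "half_norm_sq x = (1/2) * (norm x)\<^sup>2"

definition bounded_below_fun :: "('a \<Rightarrow> ereal) \<Rightarrow> bool" where
  "bounded_below_fun f \<longleftrightarrow> (INF x. f x) > - \<infinity>"

definition prox_bounded :: "('a::real_normed_vector \<Rightarrow> ereal) \<Rightarrow> bool" where
  "prox_bounded f \<longleftrightarrow> (\<exists>c>0. bounded_below_fun (\<lambda>x. f x + ereal (c * half_norm_sq x)))"

text \<open>
  This is a real infimum, hence meaningful only when the set is nonempty,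
  that is, when \<open>f\<close> is prox-bounded.
\<close>

definition prox_threshold :: "('a::real_normed_vector \<Rightarrow> ereal) \<Rightarrow> real" where
  "prox_threshold f = Inf {c. c > 0 \<and> bounded_below_fun (\<lambda>x. f x + ereal (c * half_norm_sq x))}"

definition duality_op :: "'a::real_normed_vector \<Rightarrow> ('a \<Rightarrow>\<^sub>L real) set" where
  "duality_op x = {s. blinfun_apply s x = (norm x)\<^sup>2 \<and> (norm x)\<^sup>2 = (norm s)\<^sup>2}"

definition op_range :: "('a \<Rightarrow> 'b set) \<Rightarrow> 'b set" where
  "op_range T = {s. \<exists>x. s \<in> T x}"

end

theory Submission
  imports Defs
begin

text \<open>
  Write \<open>j\<close> for \<open>half_norm_sq\<close>. Given a target functional \<open>s\<close> and an error \<open>\<delta> > 0\<close>, an element of the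
  range near \<open>s\<close> should come from a minimiser of \<open>f + c j(\<cdot> - x) - s\<close>: at such a point \<open>z\<close> the
  optimality condition reads \<open>s \<in> D f z + c J(z - x)\<close>. Since \<open>c\<close> exceeds the threshold of
  prox-boundedness, this function dominates a quadratic in \<open>norm y\<close> with positive leading
  coefficient, so it is bounded below (\<open>prox_regularisation_bounded_below\<close>). A minimiser need not
  exist, but Ekeland's variational principle supplies a \<open>z\<close> that minimises the function after the
  perturbation \<open>\<delta> dist(\<cdot>, z)\<close> has been added. The Separation Principle splits \<open>D f z\<close> from the
  subdifferential of the convex, locally Lipschitz remainder \<open>c j(\<cdot> - x) - s + \<delta> dist(\<cdot>, z)\<close>.

  This remainder must be split in turn, which calls for the sum rule of convex analysis, usually
  derived from the Hahn-Banach theorem. Here the sum rule is a consequence of the Separation Principle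
  itself: on convex functions \<open>D\<close> is the convex subdifferential, so the principle may be applied a
  second time with both summands convex (\<open>convex_subdiff_add_subset\<close>). The piece \<open>c j(\<cdot> - x)\<close>
  contributes an element of \<open>c J(z - x)\<close> and the piece \<open>\<delta> dist(\<cdot>, z)\<close> a functional of norm at most
  \<open>\<delta>\<close>, and this functional is, up to sign, the difference between \<open>s\<close> and the range point obtained.
\<close>

section \<open>Semicontinuity\<close>

lemma lsc_fun_iff:
  "lsc_fun f \<longleftrightarrow> (\<forall>x c. c < f x \<longrightarrow> (\<forall>\<^sub>F y in nhds x. c < f y))"
  unfolding lsc_fun_def le_Liminf_iff eventually_nhds_conv_at by auto

lemma lsc_fun_add_continuous:
  fixes f :: "'a::topological_space \<Rightarrow> ereal" and g :: "'a \<Rightarrow> real"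
  assumes f: "lsc_fun f" and g: "continuous_on UNIV g"
  shows "lsc_fun (\<lambda>x. f x + ereal (g x))"
  unfolding lsc_fun_iff
proof (intro allI impI)
  fix x c assume c: "c < f x + ereal (g x)"
  then have "c - ereal (g x) < f x"
    by (simp add: ereal_minus_less)
  then obtain r where r1: "c - ereal (g x) < r" and r2: "r < f x"
    using dense by blast
  have ev1: "\<forall>\<^sub>F y in nhds x. r < f y"
    using f r2 unfolding lsc_fun_iff by blast
  have cr: "c < r + ereal (g x)"
    using r1 by (simp add: ereal_minus_less)
  have "(g \<longlongrightarrow> g x) (nhds x)"
    using g by (simp add: continuous_on_def tendsto_nhds_iff)
  then have "((\<lambda>y. r + ereal (g y)) \<longlongrightarrow> r + ereal (g x)) (nhds x)"
    by (intro tendsto_add_ereal_general1 tendsto_intros) auto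
  then have "\<forall>\<^sub>F y in nhds x. c < r + ereal (g y)"
    using cr by (rule order_tendstoD)
  with ev1 show "\<forall>\<^sub>F y in nhds x. c < f y + ereal (g y)"
  proof eventually_elim
    case (elim y)
    then show ?case
      by (meson add_right_mono less_imp_le less_le_trans)
  qed
qed

lemma lsc_fun_ereal:
  fixes g :: "'a::topological_space \<Rightarrow> real"
  assumes "continuous_on UNIV g"
  shows "lsc_fun (\<lambda>x. ereal (g x))"
proof -
  have "lsc_fun (\<lambda>x::'a. 0::ereal)"
    by (simp add: lsc_fun_iff)
  from lsc_fun_add_continuous[OF this assms] show ?thesis
    by simp
qed

lemma lsc_fun_closed_sublevel:
  assumes "lsc_fun f"
  shows "closed {x. f x \<le> c}"
proof -
  have "open {x. c < f x}"
    unfolding open_subopen[of "{x. c < f x}"]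
  proof
    fix x assume "x \<in> {x. c < f x}"
    then have "\<forall>\<^sub>F y in nhds x. c < f y"
      using assms unfolding lsc_fun_iff by blast
    then show "\<exists>T. open T \<and> x \<in> T \<and> T \<subseteq> {x. c < f x}"
      unfolding eventually_nhds by blast
  qed
  moreover have "- {x. f x \<le> c} = {x. c < f x}"
    by auto
  ultimately show ?thesis
    by (simp add: closed_def)
qed

section \<open>Ekeland's variational principle\<close>

text \<open>
  The sets \<open>S x\<close> below are the lower sections of a partial order on the effective domain of \<open>h\<close>, and
  the point sought is a minimal element of that order. From a point where \<open>h\<close> is finite, each step moves to an almost
  minimiser of \<open>h\<close> within the current section; this forces the diameters of the sections to
  shrink to zero, and by completeness they intersect in a single point, whose own section can then
  contain nothing else.
\<close>

lemma ekeland_variational_principle: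
  fixes h :: "'a::complete_space \<Rightarrow> ereal"
  assumes lsc: "lsc_fun h" and lower: "\<And>x. ereal m \<le> h x"
    and x0: "h x0 < \<infinity>" and \<delta>: "\<delta> > 0"
  obtains z where "h z < \<infinity>" and "\<And>y. h z \<le> h y + ereal (\<delta> * dist y z)"
proof -
  define S where "S x = {y. h y + ereal (\<delta> * dist y x) \<le> h x}" for x
  have refl: "x \<in> S x" for x
    by (simp add: S_def)
  have trans: "S y \<subseteq> S x" if "y \<in> S x" for x y
  proof
    fix w assume "w \<in> S y"
    then have w: "h w + ereal (\<delta> * dist w y) \<le> h y"
      by (simp add: S_def)
    have y: "h y + ereal (\<delta> * dist y x) \<le> h x"
      using that by (simp add: S_def)
    have "\<delta> * dist w x \<le> \<delta> * dist w y + \<delta> * dist y x"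
      using \<delta> dist_triangle[of w x y] by (simp flip: distrib_left)
    then have "h w + ereal (\<delta> * dist w x) \<le> h w + (ereal (\<delta> * dist w y) + ereal (\<delta> * dist y x))"
      by (intro add_left_mono) simp
    also have "\<dots> = (h w + ereal (\<delta> * dist w y)) + ereal (\<delta> * dist y x)"
      by (simp only: add.assoc)
    also have "\<dots> \<le> h y + ereal (\<delta> * dist y x)"
      using w by (rule add_right_mono)
    also note y
    finally show "w \<in> S x"
      by (simp add: S_def)
  qed
  have closed: "closed (S x)" for x
    unfolding S_def
    by (intro lsc_fun_closed_sublevel lsc_fun_add_continuous lsc continuous_intros)
  have S_le: "h y \<le> h x" if "y \<in> S x" for x y
  proof -
    have "h y + 0 \<le> h y + ereal (\<delta> * dist y x)"
      using \<delta> by (intro add_left_mono) simp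
    with that show ?thesis
      by (simp add: S_def)
  qed
  have S_fin: "h y < \<infinity>" if "y \<in> S x" "h x < \<infinity>" for x y
    using S_le[OF that(1)] that(2) by (rule le_less_trans)

  have almost_min: "\<exists>y. y \<in> S x \<and> (\<forall>w\<in>S x. h y \<le> h w + ereal e)"
    if x: "h x < \<infinity>" and e: "e > 0" for x e
  proof -
    define I where "I = (INF w\<in>S x. h w)"
    have "ereal m \<le> I"
      unfolding I_def using lower by (intro INF_greatest)
    moreover have "I \<le> h x"
      unfolding I_def using refl by (intro INF_lower)
    ultimately have "\<bar>I\<bar> \<noteq> \<infinity>"
      using x by auto
    then have "I < I + ereal e"
      using e by (cases I) auto
    then obtain y where y: "y \<in> S x" "h y < I + ereal e"
      unfolding I_def INF_less_iff by blast
    have "h y \<le> h w + ereal e" if "w \<in> S x" for w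
    proof -
      have "I + ereal e \<le> h w + ereal e"
        unfolding I_def using that by (intro add_right_mono INF_lower)
      with y(2) show ?thesis
        by simp
    qed
    with y(1) show ?thesis
      by blast
  qed
  have "\<exists>X. \<forall>n. h (X n) < \<infinity> \<and>
      (X (Suc n) \<in> S (X n) \<and> (\<forall>w\<in>S (X n). h (X (Suc n)) \<le> h w + ereal (inverse (Suc n))))"
  proof (rule dependent_nat_choice)
    show "\<exists>x. h x < \<infinity>"
      using x0 by blast
  next
    fix x n assume "h x < \<infinity>"
    with almost_min[of x "inverse (Suc n)"]
    obtain y where y: "y \<in> S x" "\<forall>w\<in>S x. h y \<le> h w + ereal (inverse (Suc n))"
      by auto
    moreover have "h y < \<infinity>"
      using S_fin y(1) \<open>h x < \<infinity>\<close> by blast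
    ultimately show "\<exists>y. h y < \<infinity> \<and>
        (y \<in> S x \<and> (\<forall>w\<in>S x. h y \<le> h w + ereal (inverse (Suc n))))"
      by blast
  qed
  then obtain X where fin: "\<And>n. h (X n) < \<infinity>" and step: "\<And>n. X (Suc n) \<in> S (X n)"
    and near: "\<And>n w. w \<in> S (X n) \<Longrightarrow> h (X (Suc n)) \<le> h w + ereal (inverse (Suc n))"
    by blast

  \<comment> \<open>The shift by one makes every section of the family start at an almost minimiser.\<close>
  define T where "T n = S (X (Suc n))" for n
  have T_near: "dist w (X (Suc n)) \<le> inverse (Suc n) / \<delta>" if w: "w \<in> T n" for w n
  proof -
    have "h w + ereal (\<delta> * dist w (X (Suc n))) \<le> h (X (Suc n))"
      using w by (simp add: T_def S_def)
    also have "\<dots> \<le> h w + ereal (inverse (Suc n))"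
      using w trans[OF step[of n]] by (intro near) (auto simp: T_def)
    finally have *: "h w + ereal (\<delta> * dist w (X (Suc n))) \<le> h w + ereal (inverse (Suc n))" .
    have "h w < \<infinity>"
      using S_fin[of w "X (Suc n)"] w fin[of "Suc n"] by (simp add: T_def)
    with lower[of w] have "\<bar>h w\<bar> \<noteq> \<infinity>"
      by auto
    with * have "\<delta> * dist w (X (Suc n)) \<le> inverse (Suc n)"
      by (cases "h w") auto
    with \<delta> show ?thesis
      by (simp add: pos_le_divide_eq mult.commute)
  qed
  have "\<exists>z. \<Inter>(range T) = {z}"
  proof (rule decreasing_closed_nest_sing)
    show "closed (T n)" for n
      by (simp add: T_def closed)
    show "T n \<noteq> {}" for n
      using refl by (auto simp: T_def)
    show "T n \<subseteq> T k" if "k \<le> n" for k n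
      using that by (rule lift_Suc_antimono_le[rotated]) (simp add: T_def trans step)
    show "\<exists>n. \<forall>x\<in>T n. \<forall>y\<in>T n. dist x y < \<epsilon>" if "\<epsilon> > 0" for \<epsilon>
    proof -
      obtain n where "inverse (real (Suc n)) < \<epsilon> * \<delta> / 2"
        using reals_Archimedean[of "\<epsilon> * \<delta> / 2"] \<delta> \<open>\<epsilon> > 0\<close>
        by (metis half_gt_zero mult_pos_pos)
      then have n: "inverse (real (Suc n)) / \<delta> < \<epsilon> / 2"
        using \<delta> by (simp add: pos_divide_less_eq)
      have "dist x y < \<epsilon>" if "x \<in> T n" "y \<in> T n" for x y
        using T_near[OF that(1)] T_near[OF that(2)] n
          dist_triangle2[of x y "X (Suc n)"] by linarith
      then show ?thesis
        by blast
    qed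
  qed
  then obtain z where z: "\<Inter>(range T) = {z}" ..
  show thesis
  proof
    have "z \<in> T 0"
      using z by blast
    then show "h z < \<infinity>"
      using S_fin[of z "X (Suc 0)"] fin[of "Suc 0"] by (simp add: T_def)
    show "h z \<le> h y + ereal (\<delta> * dist y z)" for y
    proof (rule ccontr)
      assume neg: "\<not> h z \<le> h y + ereal (\<delta> * dist y z)"
      then have "y \<in> S z"
        by (simp add: S_def)
      moreover have "S z \<subseteq> T n" for n
        using z trans[of z "X (Suc n)"] unfolding T_def by blast
      ultimately have "y \<in> \<Inter>(range T)"
        by blast
      with z neg show False
        by simp
    qed
  qed
qed

section \<open>Consequences of the Separation Principle\<close>

lemma proper_fun_ereal: "proper_fun (\<lambda>x. ereal (g x))"
  by (auto simp: proper_fun_def dom_fun_def)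

lemma convex_fun_ereal:
  assumes "convex_on UNIV g"
  shows "convex_fun (\<lambda>x. ereal (g x))"
  using assms unfolding convex_fun_def convex_on_def by simp

lemma lipschitz_near_ereal:
  assumes "open U" "x \<in> U" "L-lipschitz_on U g"
  shows "lipschitz_near (\<lambda>x. ereal (g x)) x"
  using assms unfolding lipschitz_near_def by auto

text \<open>
  The Separation Principle as it is used, with a finite-valued convex summand \<open>q\<close>: on \<open>q\<close> the abstract
  subdifferential may be replaced by the convex one.
\<close>

lemma subdiff_sum_at_minimum:
  fixes D :: "('a::real_normed_vector \<Rightarrow> ereal) \<Rightarrow> 'a \<Rightarrow> ('a \<Rightarrow>\<^sub>L real) set"
    and q :: "'a \<Rightarrow> real"
  assumes D: "is_subdifferential D" "separation_principle D"
    and f: "proper_fun f" "lsc_fun f" "f z < \<infinity>"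
    and q: "convex_on UNIV q" "continuous_on UNIV q" "lipschitz_near (\<lambda>y. ereal (q y)) z"
    and min: "\<And>y. f z + ereal (q z) \<le> f y + ereal (q y)"
  shows "\<exists>s. s \<in> D f z \<and> - s \<in> convex_subdiff (\<lambda>y. ereal (q y)) z"
proof -
  let ?q = "\<lambda>y. ereal (q y)"
  have q': "proper_fun ?q" "lsc_fun ?q" "convex_fun ?q"
    using q by (simp_all add: proper_fun_ereal lsc_fun_ereal convex_fun_ereal)
  have "local_min_at (\<lambda>y. f y + ?q y) z"
    using min by (simp add: local_min_at_def)
  moreover have "z \<in> dom_fun f \<inter> dom_fun ?q"
    using f by (simp add: dom_fun_def)
  ultimately have "0 \<in> D f z + D ?q z"
    using D(2) f q q' unfolding separation_principle_def by blast
  moreover have "D ?q = convex_subdiff ?q"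
    using D(1) q' unfolding is_subdifferential_def by blast
  ultimately obtain s t where "s \<in> D f z" "t \<in> convex_subdiff ?q z" "0 = s + t"
    by (auto elim: set_plus_elim)
  moreover from this have "t = - s"
    by (simp add: eq_neg_iff_add_eq_0 add.commute)
  ultimately show ?thesis
    by blast
qed

text \<open>
  The nontrivial inclusion of the convex sum rule. If \<open>s\<close> is a subgradient of \<open>p + q\<close> at \<open>z\<close>, then \<open>z\<close>
  minimises \<open>(p - s) + q\<close>, and the Separation Principle applies to the convex functions \<open>p - s\<close> and
  \<open>q\<close>. The mere existence of a subdifferential \<open>D\<close> with this principle thus stands in for the
  Hahn-Banach theorem.
\<close>

lemma convex_subdiff_add_subset:
  fixes D :: "('a::real_normed_vector \<Rightarrow> ereal) \<Rightarrow> 'a \<Rightarrow> ('a \<Rightarrow>\<^sub>L real) set"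
    and p q :: "'a \<Rightarrow> real"
  assumes D: "is_subdifferential D" "separation_principle D"
    and p: "convex_on UNIV p" "continuous_on UNIV p"
    and q: "convex_on UNIV q" "continuous_on UNIV q" "lipschitz_near (\<lambda>y. ereal (q y)) z"
  shows "convex_subdiff (\<lambda>y. ereal (p y + q y)) z
    \<subseteq> convex_subdiff (\<lambda>y. ereal (p y)) z + convex_subdiff (\<lambda>y. ereal (q y)) z"
proof
  fix s assume s: "s \<in> convex_subdiff (\<lambda>y. ereal (p y + q y)) z"
  define r where "r y = p y + (- blinfun_apply s y)" for y
  have "convex_on UNIV (\<lambda>y. - blinfun_apply s y)"
    by (rule convex_onI) (auto simp: blinfun.bilinear_simps algebra_simps)
  then have r: "convex_on UNIV r" "continuous_on UNIV r"
    unfolding r_def using p by (intro convex_on_add continuous_intros; simp)+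
  let ?r = "\<lambda>y. ereal (r y)"
  have r': "proper_fun ?r" "lsc_fun ?r" "convex_fun ?r"
    using r by (simp_all add: proper_fun_ereal lsc_fun_ereal convex_fun_ereal)
  have "ereal (r z) + ereal (q z) \<le> ereal (r y) + ereal (q y)" for y
    using s by (auto simp: convex_subdiff_def r_def blinfun.bilinear_simps algebra_simps)
  from subdiff_sum_at_minimum[OF D r'(1,2) _ q this]
  obtain t where t: "t \<in> D ?r z" "- t \<in> convex_subdiff (\<lambda>y. ereal (q y)) z"
    by auto
  have "D ?r = convex_subdiff ?r"
    using D(1) r' unfolding is_subdifferential_def by blast
  with t(1) have "s + t \<in> convex_subdiff (\<lambda>y. ereal (p y)) z"
    by (auto simp: convex_subdiff_def r_def blinfun.bilinear_simps algebra_simps)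
  from set_plus_intro[OF this t(2)]
  show "s \<in> convex_subdiff (\<lambda>y. ereal (p y)) z + convex_subdiff (\<lambda>y. ereal (q y)) z"
    by simp
qed

section \<open>Two convex subdifferentials\<close>

lemma norm_blinfun_le_of_upper_bound:
  fixes s :: "'a::real_normed_vector \<Rightarrow>\<^sub>L real"
  assumes "b \<ge> 0" and "\<And>h. blinfun_apply s h \<le> b * norm h"
  shows "norm s \<le> b"
proof (rule norm_blinfun_bound[OF assms(1)])
  fix h show "norm (blinfun_apply s h) \<le> b * norm h"
    using assms(2)[of h] assms(2)[of "- h"] by (simp add: blinfun.bilinear_simps)
qed

lemma convex_subdiff_dist_center:
  fixes z :: "'a::real_normed_vector"
  assumes "s \<in> convex_subdiff (\<lambda>y. ereal (\<delta> * dist y z)) z" and "\<delta> \<ge> 0"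
  shows "norm s \<le> \<delta>"
proof (rule norm_blinfun_le_of_upper_bound[OF assms(2)])
  fix h
  have "ereal (blinfun_apply s ((z + h) - z)) + ereal (\<delta> * dist z z) \<le> ereal (\<delta> * dist (z + h) z)"
    using assms(1) unfolding convex_subdiff_def by blast
  then show "blinfun_apply s h \<le> \<delta> * norm h"
    by (simp add: dist_norm)
qed

lemma duality_opI:
  fixes s :: "'a::real_normed_vector \<Rightarrow>\<^sub>L real"
  assumes "blinfun_apply s y = (norm y)\<^sup>2" and "norm s \<le> norm y"
  shows "s \<in> duality_op y"
proof -
  have "norm y * norm y \<le> norm s * norm y"
    using norm_blinfun[of s y] assms(1) by (simp add: power2_eq_square)
  then have "norm y \<le> norm s"
    by (cases "y = 0") auto
  with assms show ?thesis
    by (simp add: duality_op_def)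
qed

lemma le_of_le_add_small_multiple:
  fixes a b k :: real
  assumes "\<And>t. t > 0 \<Longrightarrow> a \<le> b + t * k"
  shows "a \<le> b"
proof (rule tendsto_lowerbound)
  show "((\<lambda>t. b + t * k) \<longlongrightarrow> b) (at_right 0)"
    by (auto intro!: tendsto_eq_intros)
  show "\<forall>\<^sub>F t in at_right 0. a \<le> b + t * k"
    using assms by (simp add: eventually_at_right_less eventually_at_filter)
qed simp

text \<open>
  A subgradient of \<open>c j\<close> at \<open>v\<close> is bounded above by the directional derivatives of \<open>c j\<close> at \<open>v\<close>. By the
  triangle inequality these are at most \<open>c * norm v * norm h\<close> in the direction \<open>h\<close>, which bounds the
  dual norm; the direction \<open>- v\<close>, where the derivative is exactly \<open>- c * (norm v)\<^sup>2\<close>, gives the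
  remaining inequality for the value at \<open>v\<close>.
\<close>

lemma convex_subdiff_scaled_half_norm_sq:
  fixes x z :: "'a::real_normed_vector"
  assumes s: "s \<in> convex_subdiff (\<lambda>y. ereal (c * half_norm_sq (y - x))) z" and c: "c > 0"
  shows "s \<in> (*\<^sub>R) c ` duality_op (z - x)"
proof -
  define v where "v = z - x"
  have incr: "2 * blinfun_apply s h \<le> c * ((norm (v + h))\<^sup>2 - (norm v)\<^sup>2)" for h
  proof -
    have "ereal (blinfun_apply s ((z + h) - z)) + ereal (c * half_norm_sq (z - x))
        \<le> ereal (c * half_norm_sq ((z + h) - x))"
      using s unfolding convex_subdiff_def by blast
    moreover have "(z + h) - x = v + h"
      by (simp add: v_def)
    ultimately show ?thesis
      by (simp add: half_norm_sq_def v_def[symmetric] algebra_simps)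
  qed
  have upper: "blinfun_apply s h \<le> (c * norm v) * norm h" for h
  proof (rule le_of_le_add_small_multiple)
    fix t :: real assume t: "t > 0"
    have "2 * (t * blinfun_apply s h) \<le> c * ((norm (v + t *\<^sub>R h))\<^sup>2 - (norm v)\<^sup>2)"
      using incr[of "t *\<^sub>R h"] by (simp add: blinfun.bilinear_simps)
    also have "\<dots> \<le> c * ((norm v + t * norm h)\<^sup>2 - (norm v)\<^sup>2)"
    proof -
      have "norm (v + t *\<^sub>R h) \<le> norm v + t * norm h"
        using norm_triangle_ineq[of v "t *\<^sub>R h"] t by simp
      then have "(norm (v + t *\<^sub>R h))\<^sup>2 \<le> (norm v + t * norm h)\<^sup>2"
        by (intro power_mono) auto
      with c show ?thesis
        by simp
    qed
    also have "\<dots> = 2 * (t * ((c * norm v) * norm h + t * (c * (norm h)\<^sup>2 / 2)))"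
      by (simp add: power2_eq_square algebra_simps)
    finally show "blinfun_apply s h \<le> (c * norm v) * norm h + t * (c * (norm h)\<^sup>2 / 2)"
      using t by simp
  qed
  have lower: "c * (norm v)\<^sup>2 \<le> blinfun_apply s v"
  proof (rule le_of_le_add_small_multiple)
    fix t :: real assume t: "t > 0"
    have "v + (- t) *\<^sub>R v = (1 - t) *\<^sub>R v"
      by (simp add: algebra_simps)
    then have "- 2 * (t * blinfun_apply s v) \<le> c * ((1 - t)\<^sup>2 * (norm v)\<^sup>2 - (norm v)\<^sup>2)"
      using incr[of "(- t) *\<^sub>R v"] by (simp add: blinfun.bilinear_simps power_mult_distrib)
    then have "t * (2 * (c * (norm v)\<^sup>2)) \<le> t * (2 * (blinfun_apply s v + t * (c * (norm v)\<^sup>2 / 2)))"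
      by (simp add: power2_eq_square algebra_simps)
    with t show "c * (norm v)\<^sup>2 \<le> blinfun_apply s v + t * (c * (norm v)\<^sup>2 / 2)"
      by simp
  qed
  have "(1 / c) *\<^sub>R s \<in> duality_op v"
  proof (rule duality_opI)
    have "blinfun_apply s v = c * (norm v)\<^sup>2"
      using upper[of v] lower by (simp add: power2_eq_square)
    then show "blinfun_apply ((1 / c) *\<^sub>R s) v = (norm v)\<^sup>2"
      using c by (simp add: blinfun.bilinear_simps)
    have "norm s \<le> c * norm v"
      using upper c by (intro norm_blinfun_le_of_upper_bound) auto
    then show "norm ((1 / c) *\<^sub>R s) \<le> norm v"
      using c by (simp add: field_simps)
  qed
  moreover have "s = c *\<^sub>R ((1 / c) *\<^sub>R s)"
    using c by simp
  ultimately show ?thesis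
    unfolding v_def by blast
qed

section \<open>The regularised function\<close>

lemma convex_on_half_norm_sq:
  "convex_on UNIV (\<lambda>y::'a::real_normed_vector. half_norm_sq (y - x))"
  unfolding half_norm_sq_def
proof (intro convex_on_cmul convex_onI)
  fix t :: real and a b :: 'a
  assume t: "0 < t" "t < 1"
  have sq: "convex_on UNIV (\<lambda>r::real. r\<^sup>2)"
    by (rule convex_power2)
  have "(1 - t) *\<^sub>R a + t *\<^sub>R b - x = (1 - t) *\<^sub>R (a - x) + t *\<^sub>R (b - x)"
    by (simp add: algebra_simps)
  then have "norm ((1 - t) *\<^sub>R a + t *\<^sub>R b - x) \<le> (1 - t) * norm (a - x) + t * norm (b - x)"
    using norm_triangle_ineq[of "(1 - t) *\<^sub>R (a - x)" "t *\<^sub>R (b - x)"] t by simp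
  then have "(norm ((1 - t) *\<^sub>R a + t *\<^sub>R b - x))\<^sup>2 \<le> ((1 - t) * norm (a - x) + t * norm (b - x))\<^sup>2"
    by (intro power_mono) auto
  also have "\<dots> \<le> (1 - t) * (norm (a - x))\<^sup>2 + t * (norm (b - x))\<^sup>2"
    using convex_onD[OF sq, of t "norm (a - x)" "norm (b - x)"] t by simp
  finally show "(norm ((1 - t) *\<^sub>R a + t *\<^sub>R b - x))\<^sup>2
      \<le> (1 - t) * (norm (a - x))\<^sup>2 + t * (norm (b - x))\<^sup>2" .
qed simp_all

lemma lipschitz_on_half_norm_sq:
  fixes x z :: "'a::real_normed_vector"
  shows "(norm (z - x) + 1)-lipschitz_on (ball z 1) (\<lambda>y. half_norm_sq (y - x))"
proof (rule lipschitz_onI)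
  fix a b assume ab: "a \<in> ball z 1" "b \<in> ball z 1"
  have bound: "norm (w - x) \<le> norm (z - x) + 1" if "w \<in> ball z 1" for w
    using that norm_triangle_ineq[of "w - z" "z - x"] by (simp add: dist_norm norm_minus_commute)
  have "dist (half_norm_sq (a - x)) (half_norm_sq (b - x))
      = \<bar>norm (a - x) - norm (b - x)\<bar> * ((norm (a - x) + norm (b - x)) / 2)"
  proof -
    have "half_norm_sq (a - x) - half_norm_sq (b - x)
        = (norm (a - x) - norm (b - x)) * ((norm (a - x) + norm (b - x)) / 2)"
      by (simp add: half_norm_sq_def power2_eq_square field_simps)
    then show ?thesis
      unfolding dist_real_def by (simp only: abs_mult) simp
  qed
  also have "\<dots> \<le> dist a b * (norm (z - x) + 1)"
    using bound[OF ab(1)] bound[OF ab(2)] norm_triangle_ineq3[of "a - x" "b - x"]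
    by (intro mult_mono) (auto simp: dist_norm)
  finally show "dist (half_norm_sq (a - x)) (half_norm_sq (b - x)) \<le> (norm (z - x) + 1) * dist a b"
    by (simp add: mult.commute)
qed simp

text \<open>
  Moving the centre of the quadratic from \<open>0\<close> to \<open>x\<close> and subtracting \<open>s\<close> cost only terms linear in
  \<open>norm y\<close>, and the surplus \<open>c - b > 0\<close> in the quadratic term absorbs them. The lower bound comes
  from completing the square in \<open>(c - b) / 2 * (norm y)\<^sup>2 - K * norm y\<close>.
\<close>

lemma prox_regularisation_bounded_below:
  fixes f :: "'a::real_normed_vector \<Rightarrow> ereal" and s :: "'a \<Rightarrow>\<^sub>L real"
  assumes lower: "\<And>y. ereal m \<le> f y + ereal (b * half_norm_sq y)" and bc: "b < c" and c: "c > 0"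
  shows "\<exists>M. \<forall>y. ereal M \<le> f y + ereal (c * half_norm_sq (y - x) - blinfun_apply s y)"
proof (intro exI allI)
  fix y :: 'a
  define K where "K = c * norm x + norm s"
  have quad: "(norm (y - x))\<^sup>2 \<ge> (norm y)\<^sup>2 - 2 * (norm x * norm y)"
  proof -
    have "\<bar>norm y - norm x\<bar>\<^sup>2 \<le> (norm (y - x))\<^sup>2"
      by (intro power_mono norm_triangle_ineq3) simp
    then have "(norm y)\<^sup>2 - 2 * (norm x * norm y) + (norm x)\<^sup>2 \<le> (norm (y - x))\<^sup>2"
      by (simp add: power2_diff mult.commute)
    then show ?thesis
      using zero_le_power2[of "norm x"] by linarith
  qed
  have "blinfun_apply s y \<le> norm s * norm y"
    using norm_blinfun[of s y] by simp
  moreover have "c * half_norm_sq (y - x) \<ge> c * (((norm y)\<^sup>2 - 2 * (norm x * norm y)) / 2)"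
    using quad c unfolding half_norm_sq_def by (intro mult_left_mono) auto
  ultimately have "c * half_norm_sq (y - x) - blinfun_apply s y - b * half_norm_sq y
      \<ge> (c - b) / 2 * (norm y)\<^sup>2 - K * norm y"
    by (simp add: half_norm_sq_def K_def field_simps)
  moreover have "(c - b) / 2 * (norm y)\<^sup>2 - K * norm y \<ge> - (K\<^sup>2 / (2 * (c - b)))"
  proof -
    have "(c - b) / 2 * (norm y)\<^sup>2 - K * norm y + K\<^sup>2 / (2 * (c - b))
        = ((c - b) * norm y - K)\<^sup>2 / (2 * (c - b))"
      using bc by (simp add: field_simps power2_eq_square)
    moreover have "\<dots> \<ge> 0"
      using bc by simp
    ultimately show ?thesis
      by linarith
  qed
  ultimately have "- (K\<^sup>2 / (2 * (c - b))) + b * half_norm_sq y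
      \<le> c * half_norm_sq (y - x) - blinfun_apply s y"
    by linarith
  with lower[of y] show "ereal (m - (c * norm x + norm s)\<^sup>2 / (2 * (c - b)))
      \<le> f y + ereal (c * half_norm_sq (y - x) - blinfun_apply s y)"
    unfolding K_def by (cases "f y") auto
qed

lemma prox_threshold_lessE:
  fixes f :: "'a::real_normed_vector \<Rightarrow> ereal"
  assumes pb: "prox_bounded f" and c: "prox_threshold f < c"
  obtains b m where "0 < b" "b < c" "\<And>y. ereal m \<le> f y + ereal (b * half_norm_sq y)"
proof -
  let ?A = "{c. c > 0 \<and> bounded_below_fun (\<lambda>x. f x + ereal (c * half_norm_sq x))}"
  have "?A \<noteq> {}"
    using pb by (auto simp: prox_bounded_def)
  then obtain b where b: "b \<in> ?A" "b < c"
    using cInf_lessD[of ?A c] c unfolding prox_threshold_def by auto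
  then have "(INF x. f x + ereal (b * half_norm_sq x)) > - \<infinity>"
    by (simp add: bounded_below_fun_def)
  then obtain m where m: "ereal m < (INF x. f x + ereal (b * half_norm_sq x))"
    using ereal_dense2 by blast
  then have "ereal m \<le> f y + ereal (b * half_norm_sq y)" for y
    by (meson INF_lower UNIV_I less_imp_le less_le_trans)
  with b show thesis
    by (intro that[of b m]) auto
qed

section \<open>Density of the range\<close>

text \<open>
  The element found lies in the image of the point \<open>y = z - x\<close>, where \<open>z\<close> is the Ekeland point of
  \<open>f + c j(\<cdot> - x) - s\<close>.
\<close>

lemma approximate_range_point:
  fixes D :: "('a::banach \<Rightarrow> ereal) \<Rightarrow> 'a \<Rightarrow> ('a \<Rightarrow>\<^sub>L real) set"
  assumes D: "is_subdifferential D" "separation_principle D"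
    and f: "proper_fun f" "lsc_fun f" and pb: "prox_bounded f" "prox_threshold f < c"
    and \<delta>: "\<delta> > 0"
  shows "\<exists>w \<in> op_range (\<lambda>y. D f (x + y) + (*\<^sub>R) c ` duality_op y). norm (w - s) \<le> \<delta>"
proof -
  obtain b m where b: "0 < b" "b < c" and bm: "\<And>y. ereal m \<le> f y + ereal (b * half_norm_sq y)"
    using prox_threshold_lessE[OF pb] by metis
  then have c: "c > 0"
    by simp
  define g where "g y = c * half_norm_sq (y - x)" for y
  define l where "l y = - blinfun_apply s y" for y
  define d where "d z y = \<delta> * dist y z" for y z :: 'a
  have cont: "continuous_on UNIV g" "continuous_on UNIV l" "continuous_on UNIV (d z)" for z
    unfolding g_def l_def d_def half_norm_sq_def by (intro continuous_intros)+
  have conv: "convex_on UNIV g" "convex_on UNIV l" "convex_on UNIV (d z)" for z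
  proof -
    show "convex_on UNIV g"
      unfolding g_def using c by (intro convex_on_cmul convex_on_half_norm_sq) auto
    show "convex_on UNIV l"
      unfolding l_def by (rule convex_onI) (auto simp: blinfun.bilinear_simps algebra_simps)
    show "convex_on UNIV (d z)"
      unfolding d_def using \<delta> convex_on_dist[of UNIV z]
      by (intro convex_on_cmul) (auto simp: dist_commute)
  qed
  have lip_d: "\<delta>-lipschitz_on U (d z)" for U z
  proof (rule lipschitz_onI)
    fix y y' show "dist (d z y) (d z y') \<le> \<delta> * dist y y'"
      using \<delta> abs_dist_diff_le[of y z y']
      by (simp add: d_def dist_real_def abs_mult dist_commute[of z y'] flip: right_diff_distrib)
  qed (use \<delta> in simp)
  have lip_l: "(norm s)-lipschitz_on U l" for U
  proof (rule lipschitz_onI)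
    fix y y' show "dist (l y) (l y') \<le> norm s * dist y y'"
      using norm_blinfun[of s "y' - y"]
      by (simp add: l_def dist_real_def dist_norm blinfun.bilinear_simps norm_minus_commute)
  qed simp

  obtain x0 where x0: "f x0 < \<infinity>"
    using f(1) by (auto simp: proper_fun_def dom_fun_def)
  obtain M where M: "\<And>y. ereal M \<le> f y + ereal (g y + l y)"
    using prox_regularisation_bounded_below[of m f b c x s] bm b(2) c by (auto simp: g_def l_def)
  have "lsc_fun (\<lambda>y. f y + ereal (g y + l y))"
    using f(2) cont by (intro lsc_fun_add_continuous continuous_intros)
  then obtain z where z: "f z + ereal (g z + l z) < \<infinity>"
    "\<And>y. f z + ereal (g z + l z) \<le> f y + ereal (g y + l y) + ereal (\<delta> * dist y z)"
    using ekeland_variational_principle[of "\<lambda>y. f y + ereal (g y + l y)" M x0 \<delta>] M \<delta> x0 by auto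
  define q where "q y = (g y + l y) + d z y" for y
  have "\<exists>t. t \<in> D f z \<and> - t \<in> convex_subdiff (\<lambda>y. ereal (q y)) z"
  proof (rule subdiff_sum_at_minimum[OF D f])
    show "f z < \<infinity>"
      using z(1) by auto
    show "convex_on UNIV q" "continuous_on UNIV q"
      unfolding q_def using conv cont by (auto intro!: convex_on_add continuous_intros)
    have "(c * (norm (z - x) + 1) + norm s + \<delta>)-lipschitz_on (ball z 1) q"
      unfolding q_def g_def using c lipschitz_on_half_norm_sq[of z x]
      by (intro lipschitz_on_add lip_l lip_d lipschitz_on_cmult_real_nonneg) auto
    then show "lipschitz_near (\<lambda>y. ereal (q y)) z"
      by (rule lipschitz_near_ereal[rotated 2]) auto
    show "f z + ereal (q z) \<le> f y + ereal (q y)" for y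
      using z(2)[of y] by (simp add: q_def d_def add.assoc flip: plus_ereal.simps(1))
  qed
  then obtain t where t: "t \<in> D f z" "- t \<in> convex_subdiff (\<lambda>y. ereal (q y)) z"
    by blast
  have "convex_subdiff (\<lambda>y. ereal (q y)) z
      \<subseteq> convex_subdiff (\<lambda>y. ereal (g y + l y)) z + convex_subdiff (\<lambda>y. ereal (d z y)) z"
    unfolding q_def
  proof (rule convex_subdiff_add_subset[OF D])
    show "lipschitz_near (\<lambda>y. ereal (d z y)) z"
      by (rule lipschitz_near_ereal[OF open_UNIV UNIV_I lip_d])
  qed (use conv cont in \<open>auto intro!: convex_on_add continuous_intros\<close>)
  with t(2) obtain u v where uv: "u \<in> convex_subdiff (\<lambda>y. ereal (g y + l y)) z"
      "v \<in> convex_subdiff (\<lambda>y. ereal (d z y)) z" "- t = u + v"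
    by (blast elim: set_plus_elim)
  have "u + s \<in> convex_subdiff (\<lambda>y. ereal (g y)) z"
    using uv(1) by (auto simp: convex_subdiff_def l_def blinfun.bilinear_simps algebra_simps)
  then have J: "u + s \<in> (*\<^sub>R) c ` duality_op (z - x)"
    unfolding g_def using c by (rule convex_subdiff_scaled_half_norm_sq)
  have "norm v \<le> \<delta>"
    using uv(2) \<delta> unfolding d_def by (intro convex_subdiff_dist_center) auto
  moreover have "t + (u + s) - s = - v"
  proof -
    have "v = - t - u"
      using uv(3) by simp
    then show ?thesis
      by simp
  qed
  ultimately have "norm (t + (u + s) - s) \<le> \<delta>"
    by simp
  moreover have "t + (u + s) \<in> D f (x + (z - x)) + (*\<^sub>R) c ` duality_op (z - x)"
    using t(1) J by (intro set_plus_intro) auto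
  ultimately show ?thesis
    unfolding op_range_def by blast
qed

theorem proposition2p2:
  fixes D :: "('a::banach \<Rightarrow> ereal) \<Rightarrow> 'a \<Rightarrow> ('a \<Rightarrow>\<^sub>L real) set"
    and f :: "'a \<Rightarrow> ereal"
  assumes "is_subdifferential D"
    and "separation_principle D"
    and "proper_fun f"
    and "lsc_fun f"
    and "prox_bounded f"
  shows "\<forall>c::real. c > prox_threshold f \<longrightarrow>
    (\<forall>x. closure (op_range (\<lambda>y. D f (x + y) + (*\<^sub>R) c ` duality_op y)) = UNIV)"
proof (intro allI impI)
  fix c x assume c: "c > prox_threshold f"
  let ?R = "op_range (\<lambda>y. D f (x + y) + (*\<^sub>R) c ` duality_op y)"
  have "s \<in> closure ?R" for s
    unfolding closure_approachable
  proof (intro allI impI)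
    fix e :: real assume e: "e > 0"
    obtain w where "w \<in> ?R" "norm (w - s) \<le> e / 2"
      using approximate_range_point[OF assms c, of "e / 2" x s] e by auto
    with e show "\<exists>w\<in>?R. dist w s < e"
      by (intro bexI[of _ w]) (auto simp: dist_norm)
  qed
  then show "closure ?R = UNIV"
    by blast
qed

end
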